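(* Let $n\ge 1$ and $k\geq 3$ be integers. If a tensor $\mathcal A\in\operatorname{S}(\otimes^k\mathbb R^{n})$ is orthogonally decomposable, i.e., \[ \mathcal A=\sum_{i=1}^r\lambda_i\mathbf u_i^{\otimes k} \] for some $\lambda_1,\dots,\lambda_r\in\mathbb R$ and some matrix $[\mathbf u_1\ \dots\ \mathbf u_r]\in\mathbb R^{n\times r}$ with orthonormal columns, then each nonzero Z-eigenvector of $\mathcal A$ is nondegenerate.
   Context: $\otimes^k\mathbb R^n$ is the space of real tensors $\mathcal A=(a_{i_1\dots i_k})$ of order $k$ and dimension $n\times\dots\times n$, and $\operatorname{S}(\otimes^k\mathbb R^n)$ is its subspace of symmetric tensors (entries invariant under all permutations of the indices). The inner product is $\langle\mathcal A,\mathcal B\rangle=\sum_{i_1,\dots,i_k=1}^n a_{i_1\dots i_k}b_{i_1\dots i_k}$. For a vector $\mathbf x$ with entries $x_i$, $\mathbf x^{\otimes k}$ is the tensor with entries $x_{i_1}\cdots x_{i_k}$. $\mathbb S^{n-1}$ is the unit sphere in $\mathbb R^n$ for the Euclidean norm. A vector $\mathbf x\in\mathbb S^{n-1}$ is a Z-eigenvector of $\mathcal A$ if it is a critical point of the smooth function $S(\mathbf x):=\langle\mathcal A,\mathbf x^{\otimes k}\rangle$ on $\mathbb S^{n-1}$; the corresponding Z-eigenvalue is $\lambda=\langle\mathcal A,\mathbf x^{\otimes k}\rangle$. It is called a nonzero Z-eigenvector if $\lambda\neq 0$. A Z-eigenvector $\mathbf x$ is nondegenerate if it is a nondegenerate critical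 point of $S$ on $\mathbb S^{n-1}$, i.e., the Riemannian Hessian of $S$ at $\mathbf x$ (for the metric on the sphere induced from $\mathbb R^n$) is a nonsingular linear map from the tangent space of $\mathbb S^{n-1}$ at $\mathbf x$ to itself. *)

theory Defs
  imports "HOL-Analysis.Analysis"
begin

(* A real tensor of order k = CARD('k) and dimension n x ... x n, n = CARD('n), is a vector
   indexed by the multi-indices 'k => 'n. The library inner product of this type is then the
   sum over all multi-indices of the products of entries, i.e. the tensor inner product. *)

type_synonym ('n, 'k) tensor = "real ^ ('k \<Rightarrow> 'n)"

definition symmetric_tensor :: "('n::finite, 'k::finite) tensor \<Rightarrow> bool" where
  "symmetric_tensor A \<longleftrightarrow> (\<forall>p i. bij p \<longrightarrow> A $ (i \<circ> p) = A $ i)"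

definition tensor_power :: "real ^ 'n::finite \<Rightarrow> ('n, 'k::finite) tensor" where
  "tensor_power x = (\<chi> i. \<Prod>j\<in>UNIV. x $ i j)"

definition orthogonally_decomposable :: "('n::finite, 'k::finite) tensor \<Rightarrow> bool" where
  "orthogonally_decomposable A \<longleftrightarrow>
     (\<exists>(r::nat) (l :: nat \<Rightarrow> real) (u :: nat \<Rightarrow> real ^ 'n).
        (\<forall>i\<in>{1..r}. \<forall>j\<in>{1..r}. u i \<bullet> u j = (if i = j then 1 else 0)) \<and>
        A = (\<Sum>i=1..r. l i *\<^sub>R tensor_power (u i)))"

definition sphere_tangent_space :: "'a::euclidean_space \<Rightarrow> 'a set" where
  "sphere_tangent_space x = {v. x \<bullet> v = 0}"

(* For norm x = 1 this is the orthogonal projection onto the tangent space at x. *)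

definition sphere_tangent_proj :: "'a::euclidean_space \<Rightarrow> 'a \<Rightarrow> 'a" where
  "sphere_tangent_proj x v = v - (x \<bullet> v) *\<^sub>R x"

(* Functions on the unit sphere are given by a smooth extension f to the whole space. Critical
   points, Riemannian gradient and Hessian at points of the sphere (on tangent vectors) depend
   only on the restriction of f to the sphere. The differential at x of the
   restriction is the restriction of the differential of f to the tangent space at x. *)

definition sphere_critical_point :: "('a::euclidean_space \<Rightarrow> real) \<Rightarrow> 'a \<Rightarrow> bool" where
  "sphere_critical_point f x \<longleftrightarrow>
     x \<in> sphere 0 1 \<and> (\<forall>v\<in>sphere_tangent_space x. frechet_derivative f (at x) v = 0)"

definition gradient :: "('a::euclidean_space \<Rightarrow> real) \<Rightarrow> 'a \<Rightarrow> 'a" where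
  "gradient f x = (THE g. GDERIV f x :> g)"

(* On the sphere this is the Riemannian gradient for the induced metric. Off the sphere it is
   merely a smooth extension of that vector field. *)

definition sphere_gradient :: "('a::euclidean_space \<Rightarrow> real) \<Rightarrow> 'a \<Rightarrow> 'a" where
  "sphere_gradient f x = sphere_tangent_proj x (gradient f x)"

(* The Riemannian Hessian is v |-> nabla_v (grad f). The Levi-Civita connection of the induced
   metric is the tangential part of the Euclidean derivative of an extension of the vector field;
   for v tangent to the sphere the result does not depend on the extension. *)

definition sphere_hessian :: "('a::euclidean_space \<Rightarrow> real) \<Rightarrow> 'a \<Rightarrow> 'a \<Rightarrow> 'a" where
  "sphere_hessian f x v =
     sphere_tangent_proj x (frechet_derivative (sphere_gradient f) (at x) v)"

definition sphere_nondegenerate_critical_point ::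
    "('a::euclidean_space \<Rightarrow> real) \<Rightarrow> 'a \<Rightarrow> bool" where
  "sphere_nondegenerate_critical_point f x \<longleftrightarrow>
     sphere_critical_point f x \<and>
     bij_betw (sphere_hessian f x) (sphere_tangent_space x) (sphere_tangent_space x)"

definition tensor_form :: "('n::finite, 'k::finite) tensor \<Rightarrow> real ^ 'n \<Rightarrow> real" where
  "tensor_form A x = A \<bullet> tensor_power x"

definition Z_eigenvector :: "('n::finite, 'k::finite) tensor \<Rightarrow> real ^ 'n \<Rightarrow> bool" where
  "Z_eigenvector A x \<longleftrightarrow> sphere_critical_point (tensor_form A) x"

(* The Z-eigenvalue corresponding to a Z-eigenvector x is tensor_form A x. *)

definition nonzero_Z_eigenvector :: "('n::finite, 'k::finite) tensor \<Rightarrow> real ^ 'n \<Rightarrow> bool" where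
  "nonzero_Z_eigenvector A x \<longleftrightarrow> Z_eigenvector A x \<and> tensor_form A x \<noteq> 0"

definition nondegenerate_Z_eigenvector ::
    "('n::finite, 'k::finite) tensor \<Rightarrow> real ^ 'n \<Rightarrow> bool" where
  "nondegenerate_Z_eigenvector A x \<longleftrightarrow>
     Z_eigenvector A x \<and> sphere_nondegenerate_critical_point (tensor_form A) x"

end

theory Submission
  imports Defs
begin

text \<open>
  For an orthogonally decomposable tensor the form to study is a sum of powers of orthogonal
  linear functionals, \<open>f(y) = \<Sum>\<^sub>i l\<^sub>i (u\<^sub>i \<bullet> y)\<^sup>k\<close>. Let \<open>x\<close> be a critical point on the sphere with
  \<open>f(x) \<noteq> 0\<close>. Criticality says that the Euclidean gradient is a multiple of \<open>x\<close>, and Euler's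
  identity identifies the multiple as \<open>k f(x)\<close>. Comparing coefficients along \<open>u\<^sub>i\<close> shows that each
  number \<open>l\<^sub>i (u\<^sub>i \<bullet> x)\<^sup>k\<^sup>-\<^sup>2\<close> equals \<open>f(x)\<close> if \<open>u\<^sub>i \<bullet> x \<noteq> 0\<close>, and it vanishes otherwise because
  \<open>k > 2\<close>.

  Up to the factor \<open>k (k - 1)\<close> these numbers are the eigenvalues of the Euclidean Hessian on the
  span of the \<open>u\<^sub>i\<close>, and the Hessian vanishes on the orthogonal complement of that span. So it is
  \<open>k (k - 1) f(x) P\<close> for the orthogonal projection \<open>P\<close> onto the span of those \<open>u\<^sub>i\<close> that are not
  orthogonal to \<open>x\<close>. Passing to the sphere subtracts \<open>k f(x)\<close> times the identity, so that the
  Riemannian Hessian is \<open>k f(x) ((k - 1) P - id)\<close>. An operator \<open>m P - id\<close> with \<open>P\<close> idempotent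
  has the inverse \<open>(m / (m - 1)) P - id\<close> as soon as \<open>m \<noteq> 1\<close>, and here \<open>m - 1 = k - 2 \<noteq> 0\<close>.
  Finally \<open>P\<close> is self-adjoint, and it fixes \<open>x\<close> because \<open>x\<close> is a multiple of the gradient. Hence
  it preserves the tangent space at \<open>x\<close>, and so do the operator and its inverse.
\<close>

section \<open>Tensor forms as sums of powers\<close>

text \<open>Expanding the product of the \<open>k\<close> inner products gives one term for each multi-index.\<close>

lemma inner_tensor_power:
  fixes x y :: "real ^ 'n::finite"
  shows "(tensor_power x :: ('n, 'k::finite) tensor) \<bullet> tensor_power y = (x \<bullet> y) ^ CARD('k)"
proof -
  have "(x \<bullet> y) ^ CARD('k) = (\<Prod>j\<in>(UNIV::'k set). \<Sum>i\<in>UNIV. x $ i * y $ i)"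
    by (simp add: inner_vec_def)
  also have "\<dots> = (\<Sum>p\<in>(UNIV::'k set) \<rightarrow>\<^sub>E UNIV. \<Prod>j\<in>UNIV. x $ p j * y $ p j)"
    by (rule prod_sum_PiE) auto
  also have "(UNIV::'k set) \<rightarrow>\<^sub>E (UNIV :: 'n set) = UNIV"
    by auto
  finally show ?thesis
    by (simp add: inner_vec_def tensor_power_def prod.distrib)
qed

section \<open>Calculus on the sphere\<close>

lemma gradient_eqI:
  assumes "GDERIV f x :> g"
  shows "gradient f x = g"
  unfolding gradient_def
proof (rule the_equality)
  fix g' assume "GDERIV f x :> g'"
  with assms have "(\<lambda>h. h \<bullet> g') = (\<lambda>h. h \<bullet> g)"
    unfolding gderiv_def by (blast intro: has_derivative_unique)
  then have "(g' - g) \<bullet> g' = (g' - g) \<bullet> g" by metis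
  then have "(g' - g) \<bullet> (g' - g) = 0" by (simp add: inner_diff_right)
  then show "g' = g" by simp
qed (fact assms)

text \<open>The component of the gradient orthogonal to \<open>x\<close> is itself a tangent vector, so the vanishing
  of the differential on tangent vectors leaves only the radial component.\<close>

lemma sphere_critical_point_gradient:
  assumes "sphere_critical_point f x" and "GDERIV f x :> g"
  shows "g = (x \<bullet> g) *\<^sub>R x"
proof -
  have nx: "x \<bullet> x = 1"
    using assms(1) by (simp add: sphere_critical_point_def dot_square_norm)
  define w where "w = g - (x \<bullet> g) *\<^sub>R x"
  have xw: "x \<bullet> w = 0"
    by (simp add: w_def inner_diff_right nx)
  then have "frechet_derivative f (at x) w = 0"
    using assms(1) by (simp add: sphere_critical_point_def sphere_tangent_space_def)
  moreover have "frechet_derivative f (at x) = (\<lambda>h. h \<bullet> g)"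
    using assms(2) unfolding gderiv_def by (rule frechet_derivative_at [symmetric])
  ultimately have "w \<bullet> g = 0" by simp
  then have "w \<bullet> w = 0"
    using xw by (simp add: w_def inner_diff_right inner_commute)
  then show ?thesis by (simp add: w_def)
qed

text \<open>The last term is the curvature correction: it comes from differentiating the radial part
  \<open>(y \<bullet> g y) y\<close> that the tangential projection removes, and it is the only trace of that part which
  survives projecting once more.\<close>

lemma sphere_hessian_eq:
  assumes grad: "\<And>y. GDERIV f y :> g y"
    and hess: "(g has_derivative H) (at x)"
    and x: "norm x = 1" and v: "v \<in> sphere_tangent_space x"
  shows "sphere_hessian f x v = sphere_tangent_proj x (H v) - (x \<bullet> g x) *\<^sub>R v"
proof -
  have nx: "x \<bullet> x = 1" using x by (simp add: dot_square_norm)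
  have xv: "x \<bullet> v = 0" using v by (simp add: sphere_tangent_space_def)
  have sg: "sphere_gradient f = (\<lambda>y. g y - (y \<bullet> g y) *\<^sub>R y)"
    by (auto simp: sphere_gradient_def sphere_tangent_proj_def gradient_eqI [OF grad])
  have "(sphere_gradient f has_derivative
      (\<lambda>h. H h - ((x \<bullet> g x) *\<^sub>R h + (x \<bullet> H h + h \<bullet> g x) *\<^sub>R x))) (at x)"
    unfolding sg by (auto intro!: derivative_eq_intros hess)
  from frechet_derivative_at [OF this, symmetric] show ?thesis
    by (simp add: sphere_hessian_def sphere_tangent_proj_def inner_diff_right inner_add_right
        nx xv algebra_simps)
qed

section \<open>Perturbed projections\<close>

text \<open>The inverse of \<open>m P - id\<close> is again of the form \<open>b P - id\<close>, and comparing coefficients of \<open>P\<close>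
  in the product forces \<open>b (m - 1) = m\<close>.\<close>

lemma bij_betw_scaled_projection_minus_id:
  assumes P: "linear P" and idem: "\<And>v. P (P v) = P v"
    and V: "subspace V" and PV: "\<And>v. v \<in> V \<Longrightarrow> P v \<in> V"
    and c: "c \<noteq> 0" and m: "m \<noteq> 1"
  shows "bij_betw (\<lambda>v. c *\<^sub>R (m *\<^sub>R P v - v)) V V"
proof -
  define b where "b = m / (m - 1)"
  have "b * (m - 1) = m"
    using m by (simp add: b_def)
  then have b: "b * m - b = m"
    by (simp add: algebra_simps)
  show ?thesis
  proof (rule bij_betw_byWitness [where f' = "\<lambda>w. inverse c *\<^sub>R (b *\<^sub>R P w - w)"])
    have "m *\<^sub>R (b *\<^sub>R P w - P w) - (b *\<^sub>R P w - w) = (b * m - b - m) *\<^sub>R P w + w"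
      "b *\<^sub>R (m *\<^sub>R P w - P w) - (m *\<^sub>R P w - w) = (b * m - b - m) *\<^sub>R P w + w" for w
      by (simp_all add: algebra_simps)
    then have *: "m *\<^sub>R (b *\<^sub>R P w - P w) - (b *\<^sub>R P w - w) = w"
      "b *\<^sub>R (m *\<^sub>R P w - P w) - (m *\<^sub>R P w - w) = w" for w
      using b by simp_all
    have cancel: "s *\<^sub>R P (t *\<^sub>R z) - t *\<^sub>R z = t *\<^sub>R (s *\<^sub>R P z - z)" for s t z
      by (simp add: linear_cmul [OF P] algebra_simps)
    show "\<forall>v\<in>V. inverse c *\<^sub>R (b *\<^sub>R P (c *\<^sub>R (m *\<^sub>R P v - v)) - c *\<^sub>R (m *\<^sub>R P v - v)) = v"
      unfolding cancel using c * by (simp add: linear_diff [OF P] linear_cmul [OF P] idem)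
    show "\<forall>v\<in>V. c *\<^sub>R (m *\<^sub>R P (inverse c *\<^sub>R (b *\<^sub>R P v - v)) - inverse c *\<^sub>R (b *\<^sub>R P v - v)) = v"
      unfolding cancel using c * by (simp add: linear_diff [OF P] linear_cmul [OF P] idem)
  qed (auto intro!: subspace_scale subspace_diff V PV)
qed

section \<open>Sums of powers of orthogonal linear functionals\<close>

lemma gderiv_sum_powers:
  assumes "finite I"
  shows "GDERIV (\<lambda>y. \<Sum>i\<in>I. l i * (u i \<bullet> y) ^ k) y :>
           (\<Sum>i\<in>I. (real k * l i * (u i \<bullet> y) ^ (k - 1)) *\<^sub>R u i)"
  unfolding gderiv_def
  by (auto intro!: derivative_eq_intros sum.cong
      simp: inner_sum_right inner_commute)

lemma has_derivative_gradient_sum_powers: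
  assumes "finite I"
  shows "((\<lambda>y. \<Sum>i\<in>I. (real k * l i * (u i \<bullet> y) ^ (k - 1)) *\<^sub>R u i) has_derivative
      (\<lambda>v. \<Sum>i\<in>I. (real k * real (k - 1) * (l i * (u i \<bullet> x) ^ (k - 2)) * (u i \<bullet> v)) *\<^sub>R u i))
      (at x)"
  by (auto intro!: derivative_eq_intros sum.cong simp: numeral_2_eq_2)

lemma inner_orthonormal_sum:
  assumes "finite I" and "\<And>i j. i \<in> I \<Longrightarrow> j \<in> I \<Longrightarrow> u i \<bullet> u j = (if i = j then 1 else 0)"
    and "j \<in> I"
  shows "u j \<bullet> (\<Sum>i\<in>I. a i *\<^sub>R u i) = a j"
proof -
  have "u j \<bullet> (\<Sum>i\<in>I. a i *\<^sub>R u i) = (\<Sum>i\<in>I. if i = j then a i else 0)"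
    unfolding inner_sum_right using assms by (intro sum.cong) auto
  then show ?thesis using assms by simp
qed

text \<open>The bound on \<open>k\<close> enters twice: it makes the Hessian vanish along those \<open>u i\<close> that are
  orthogonal to \<open>x\<close>, and it gives \<open>k - 1 \<noteq> 1\<close> for the inverse. For \<open>k = 2\<close> the conclusion can
  fail, since an eigenvalue of a symmetric matrix may be multiple.\<close>

lemma nonzero_critical_point_sum_powers_nondegenerate:
  fixes u :: "'i \<Rightarrow> 'a::euclidean_space" and l :: "'i \<Rightarrow> real"
    and I :: "'i set" and k :: nat
  defines "f \<equiv> \<lambda>y. \<Sum>i\<in>I. l i * (u i \<bullet> y) ^ k"
  assumes I: "finite I"
    and orth: "\<And>i j. i \<in> I \<Longrightarrow> j \<in> I \<Longrightarrow> u i \<bullet> u j = (if i = j then 1 else 0)"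
    and k: "k \<ge> 3"
    and crit: "sphere_critical_point f x" and nz: "f x \<noteq> 0"
  shows "sphere_nondegenerate_critical_point f x"
proof -
  define g where "g = (\<lambda>y. \<Sum>i\<in>I. (real k * l i * (u i \<bullet> y) ^ (k - 1)) *\<^sub>R u i)"
  define H where "H = (\<lambda>v. \<Sum>i\<in>I.
    (real k * real (k - 1) * (l i * (u i \<bullet> x) ^ (k - 2)) * (u i \<bullet> v)) *\<^sub>R u i)"
  define c where "c = f x"
  define J where "J = {i\<in>I. u i \<bullet> x \<noteq> 0}"
  define P where "P = (\<lambda>v. \<Sum>i\<in>J. (u i \<bullet> v) *\<^sub>R u i)"
  have J: "finite J" "J \<subseteq> I" using I by (auto simp: J_def)
  have grad: "GDERIV f y :> g y" for y
    unfolding f_def g_def using I by (rule gderiv_sum_powers)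
  have hess: "(g has_derivative H) (at x)"
    unfolding g_def H_def using I by (rule has_derivative_gradient_sum_powers)
  have nx: "norm x = 1" using crit by (simp add: sphere_critical_point_def)
  have pow: "t ^ k = t * t ^ (k - Suc 0)" "t ^ (k - Suc 0) = t * t ^ (k - 2)" for t :: real
    using k by (simp_all flip: power_Suc add: Suc_diff_Suc numeral_2_eq_2)

  (* Euler's identity for homogeneous functions *)
  have euler: "x \<bullet> g x = real k * c"
    by (simp add: g_def c_def f_def inner_sum_right sum_distrib_left pow(1) inner_commute mult_ac)
  then have gx: "g x = (real k * c) *\<^sub>R x"
    using sphere_critical_point_gradient [OF crit grad] by simp
  have coeff: "l i * (u i \<bullet> x) ^ (k - 2) = (if i \<in> J then c else 0)" if i: "i \<in> I" for i
  proof (cases "i \<in> J")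
    case True
    have "real k * l i * (u i \<bullet> x) ^ (k - 1) = u i \<bullet> g x"
      unfolding g_def by (rule inner_orthonormal_sum [OF I orth i, symmetric])
    also have "\<dots> = real k * c * (u i \<bullet> x)"
      by (simp add: gx)
    finally show ?thesis
      using True k by (auto simp: pow(2) J_def)
  next
    case False
    then show ?thesis using i k by (auto simp: J_def)
  qed
  have H_eq: "H v = (real k * real (k - 1) * c) *\<^sub>R P v" for v
  proof -
    have "H v = (\<Sum>i\<in>I. if i \<in> J then (real k * real (k - 1) * c * (u i \<bullet> v)) *\<^sub>R u i else 0)"
      unfolding H_def by (intro sum.cong) (auto simp: coeff)
    also have "\<dots> = (\<Sum>i\<in>J. (real k * real (k - 1) * c * (u i \<bullet> v)) *\<^sub>R u i)"
      using I J(2) by (simp add: sum.If_cases Int_absorb1)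
    finally show ?thesis
      by (simp add: P_def scaleR_sum_right)
  qed

  have linP: "linear P"
    unfolding P_def
    by (intro linearI) (simp_all add: inner_add_right scaleR_add_left sum.distrib scaleR_sum_right)
  have orthJ: "i \<in> J \<Longrightarrow> j \<in> J \<Longrightarrow> u i \<bullet> u j = (if i = j then 1 else 0)" for i j
    using orth J(2) by blast
  have idem: "P (P v) = P v" for v
  proof -
    have "u i \<bullet> P v = u i \<bullet> v" if "i \<in> J" for i
      unfolding P_def by (rule inner_orthonormal_sum [OF J(1) orthJ that])
    then have "(\<Sum>i\<in>J. (u i \<bullet> P v) *\<^sub>R u i) = (\<Sum>i\<in>J. (u i \<bullet> v) *\<^sub>R u i)"
      by simp
    then show ?thesis by (simp add: P_def)
  qed
  have selfadj: "v \<bullet> P w = P v \<bullet> w" for v w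
    by (simp add: P_def inner_sum_left inner_sum_right inner_commute mult.commute)

  (* The gradient lies in the span that P projects onto, and x is a multiple of it. *)
  have Px: "P x = x"
  proof -
    have "(real k * c) *\<^sub>R P x = (\<Sum>i\<in>I. if i \<in> J then (real k * c * (u i \<bullet> x)) *\<^sub>R u i else 0)"
      using I J(2) by (simp add: P_def scaleR_sum_right sum.If_cases Int_absorb1)
    also have "\<dots> = g x"
      unfolding g_def
    proof (intro sum.cong refl)
      fix i assume "i \<in> I"
      then have "real k * l i * (u i \<bullet> x) ^ (k - 1) = (if i \<in> J then real k * c * (u i \<bullet> x) else 0)"
        using coeff [of i] by (auto simp: pow(2) mult_ac)
      then show "(if i \<in> J then (real k * c * (u i \<bullet> x)) *\<^sub>R u i else 0) =
          (real k * l i * (u i \<bullet> x) ^ (k - 1)) *\<^sub>R u i"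
        by simp
    qed
    finally show ?thesis using gx nz k by (simp add: c_def)
  qed
  have tangent: "P v \<in> sphere_tangent_space x" if "v \<in> sphere_tangent_space x" for v
    using that by (simp add: sphere_tangent_space_def selfadj Px)
  have "sphere_hessian f x v = (real k * c) *\<^sub>R (real (k - 1) *\<^sub>R P v - v)"
    if v: "v \<in> sphere_tangent_space x" for v
  proof -
    have "sphere_tangent_proj x (H v) = H v"
      using tangent [OF v] by (simp add: H_eq sphere_tangent_proj_def sphere_tangent_space_def)
    then show ?thesis
      using sphere_hessian_eq [OF grad hess nx v] by (simp add: H_eq euler algebra_simps)
  qed
  moreover have "bij_betw (\<lambda>v. (real k * c) *\<^sub>R (real (k - 1) *\<^sub>R P v - v))
      (sphere_tangent_space x) (sphere_tangent_space x)"
    using linP idem _ tangent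
  proof (rule bij_betw_scaled_projection_minus_id)
    show "subspace (sphere_tangent_space x)"
      unfolding sphere_tangent_space_def by (rule subspace_hyperplane)
  qed (use nz k in \<open>auto simp: c_def\<close>)
  ultimately have "bij_betw (sphere_hessian f x)
      (sphere_tangent_space x) (sphere_tangent_space x)"
    by (simp cong: bij_betw_cong)
  with crit show ?thesis
    by (simp add: sphere_nondegenerate_critical_point_def)
qed

section \<open>Orthogonally decomposable tensors\<close>

theorem theorem4p7:
  fixes A :: "('n::finite, 'k::finite) tensor"
  assumes "CARD('n) \<ge> 1" and "CARD('k) \<ge> 3"
    and "symmetric_tensor A"
    and "orthogonally_decomposable A"
  shows "\<forall>x. nonzero_Z_eigenvector A x \<longrightarrow> nondegenerate_Z_eigenvector A x"
proof -
  obtain r :: nat and l and u :: "nat \<Rightarrow> real ^ 'n"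
    where orth: "\<forall>i\<in>{1..r}. \<forall>j\<in>{1..r}. u i \<bullet> u j = (if i = j then 1 else 0)"
      and A: "A = (\<Sum>i=1..r. l i *\<^sub>R tensor_power (u i))"
    using assms(4) unfolding orthogonally_decomposable_def by blast
  have form: "tensor_form A = (\<lambda>y. \<Sum>i=1..r. l i * (u i \<bullet> y) ^ CARD('k))"
    by (rule ext) (simp add: tensor_form_def A inner_sum_left inner_tensor_power)
  show ?thesis
    unfolding nonzero_Z_eigenvector_def nondegenerate_Z_eigenvector_def Z_eigenvector_def form
    using nonzero_critical_point_sum_powers_nondegenerate [of "{1..r}" u "CARD('k)" l] orth assms(2)
    by simp
qed

end
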